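(* Every $\sqrt{J}$-clean ring is a clean ring.
   Context: Rings are associative with identity $1\neq 0$ (not necessarily commutative). $J(R)$ is the Jacobson radical of $R$, and $\sqrt{J(R)}=\{z\in R : z^n\in J(R)\text{ for some } n\ge 1\}$. A ring $R$ is $\sqrt{J}$-clean if every $x\in R$ can be written as $x=e+z$ with $e$ an idempotent of $R$ and $z\in\sqrt{J(R)}$. A ring $R$ is clean if every $a\in R$ can be written as $a=e+u$ with $e$ an idempotent and $u$ a unit of $R$. *)

theory Defs
  imports "HOL-Algebra.Ideal"
begin

locale left_ideal = additive_subgroup I R + ring R for I and R (structure) +
  assumes I_l_closed: "\<lbrakk>a \<in> I; x \<in> carrier R\<rbrakk> \<Longrightarrow> x \<otimes> a \<in> I"

locale maximal_left_ideal = left_ideal +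
  assumes I_notcarr: "carrier R \<noteq> I"
    and I_maximal: "\<lbrakk>left_ideal J R; I \<subseteq> J; J \<subseteq> carrier R\<rbrakk> \<Longrightarrow> J = I \<or> J = carrier R"

text \<open>
  The Jacobson radical is the intersection of all maximal left ideals. One-sided ideals are
  essential: the library's \<open>maximalideal\<close> is two-sided, and for a noncommutative ring the
  intersection of the maximal two-sided ideals is in general strictly larger.
\<close>

definition jacobson_radical :: "('a, 'm) ring_scheme \<Rightarrow> 'a set" where
  "jacobson_radical R = {x \<in> carrier R. \<forall>M. maximal_left_ideal M R \<longrightarrow> x \<in> M}"

definition sqrt_jacobson_radical :: "('a, 'm) ring_scheme \<Rightarrow> 'a set" where
  "sqrt_jacobson_radical R =
     {z \<in> carrier R. \<exists>n::nat. n \<ge> 1 \<and> z [^]\<^bsub>R\<^esub> n \<in> jacobson_radical R}"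

definition idempotents :: "('a, 'm) ring_scheme \<Rightarrow> 'a set" where
  "idempotents R = {e \<in> carrier R. e \<otimes>\<^bsub>R\<^esub> e = e}"

definition sqrt_J_clean :: "('a, 'm) ring_scheme \<Rightarrow> bool" where
  "sqrt_J_clean R \<longleftrightarrow>
     (\<forall>x \<in> carrier R. \<exists>e \<in> idempotents R. \<exists>z \<in> sqrt_jacobson_radical R. x = e \<oplus>\<^bsub>R\<^esub> z)"

definition clean :: "('a, 'm) ring_scheme \<Rightarrow> bool" where
  "clean R \<longleftrightarrow>
     (\<forall>a \<in> carrier R. \<exists>e \<in> idempotents R. \<exists>u \<in> Units R. a = e \<oplus>\<^bsub>R\<^esub> u)"

end

theory Submission
  imports Defs
begin

text \<open>
  Adding \<open>1\<close> turns an element of \<open>\<surd>J(R)\<close> into a unit. So a decomposition \<open>a - 1 = e + z\<close>, with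
  \<open>e\<close> idempotent and \<open>z\<close> in \<open>\<surd>J(R)\<close>, gives the clean decomposition \<open>a = e + (1 + z)\<close>.

  That \<open>1 + z\<close> is a unit reduces to the classical fact that \<open>1 - x\<close> is a unit for \<open>x\<close> in \<open>J(R)\<close>:
  put \<open>w = -z\<close>; some power \<open>w\<^sup>n\<close> lies in \<open>J(R)\<close>, and \<open>1 - w\<close> divides the unit \<open>1 - w\<^sup>n\<close> on both sides,
  by the geometric sum. The classical fact itself rests on Zorn's lemma, in the form that every
  proper left ideal lies in a maximal one.
\<close>

section \<open>Left ideals and maximal left ideals\<close>

context ring
begin

lemma left_idealI:
  assumes "I \<subseteq> carrier R" and "\<zero> \<in> I"
    and "\<And>a b. \<lbrakk>a \<in> I; b \<in> I\<rbrakk> \<Longrightarrow> a \<oplus> b \<in> I"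
    and lmult: "\<And>a x. \<lbrakk>a \<in> I; x \<in> carrier R\<rbrakk> \<Longrightarrow> x \<otimes> a \<in> I"
  shows "left_ideal I R"
proof -
  have "\<ominus> a \<in> I" if "a \<in> I" for a
  proof -
    have "(\<ominus> \<one>) \<otimes> a \<in> I"
      using that by (simp add: lmult)
    then show ?thesis
      using that assms(1) by (auto simp: l_minus)
  qed
  then have "subgroup I (add_monoid R)"
    using assms by (intro add.subgroupI) (auto simp: a_inv_def)
  then show ?thesis
    using lmult
    by (auto simp: left_ideal_def left_ideal_axioms_def additive_subgroup_def ring_axioms)
qed

lemma left_ideal_eq_carrier_if_one:
  assumes "left_ideal I R" and "\<one> \<in> I"
  shows "I = carrier R"
proof -
  interpret left_ideal I R by fact
  show ?thesis
    using I_l_closed[OF assms(2)] a_subset by fastforce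
qed

lemma left_ideal_left_multiples:
  assumes u: "u \<in> carrier R"
  shows "left_ideal ((\<lambda>r. r \<otimes> u) ` carrier R) R"
proof (rule left_idealI)
  show "\<zero> \<in> (\<lambda>r. r \<otimes> u) ` carrier R"
    using u by (intro image_eqI[of _ _ \<zero>]) auto
next
  fix a b assume "a \<in> (\<lambda>r. r \<otimes> u) ` carrier R" "b \<in> (\<lambda>r. r \<otimes> u) ` carrier R"
  then obtain r s where "r \<in> carrier R" "s \<in> carrier R" "a = r \<otimes> u" "b = s \<otimes> u"
    by auto
  then show "a \<oplus> b \<in> (\<lambda>r. r \<otimes> u) ` carrier R"
    using u by (intro image_eqI[of _ _ "r \<oplus> s"]) (auto simp: l_distr)
next
  fix a x assume "a \<in> (\<lambda>r. r \<otimes> u) ` carrier R" and x: "x \<in> carrier R"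
  then obtain r where "r \<in> carrier R" "a = r \<otimes> u"
    by auto
  then show "x \<otimes> a \<in> (\<lambda>r. r \<otimes> u) ` carrier R"
    using u x by (intro image_eqI[of _ _ "x \<otimes> r"]) (auto simp: m_assoc)
qed (use u in auto)

lemma left_ideal_chain_Union:
  assumes "C \<noteq> {}" and chain: "subset.chain {I. left_ideal I R} C"
  shows "left_ideal (\<Union>C) R"
proof (rule left_idealI)
  have ideals: "left_ideal I R" if "I \<in> C" for I
    using chain that by (auto simp: subset.chain_def)
  note sub = left_ideal.axioms(1)[OF ideals]
  show "\<Union>C \<subseteq> carrier R"
    using additive_subgroup.a_subset[OF sub] by blast
  show "\<zero> \<in> \<Union>C"
    using additive_subgroup.zero_closed[OF sub] assms(1) by blast
  show "a \<oplus> b \<in> \<Union>C" if ab: "a \<in> \<Union>C" "b \<in> \<Union>C" for a b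
  proof -
    obtain I K where "I \<in> C" "K \<in> C" "a \<in> I" "b \<in> K"
      using ab by blast
    moreover have "I \<subseteq> K \<or> K \<subseteq> I"
      using chain \<open>I \<in> C\<close> \<open>K \<in> C\<close> by (auto simp: subset.chain_def)
    ultimately obtain L where "L \<in> C" "a \<in> L" "b \<in> L"
      by blast
    then show ?thesis
      using additive_subgroup.a_closed[OF sub] by blast
  qed
  show "x \<otimes> a \<in> \<Union>C" if "a \<in> \<Union>C" "x \<in> carrier R" for a x
    using left_ideal.I_l_closed[OF ideals] that by blast
qed

text \<open>
  Properness of a left ideal amounts to not containing \<open>1\<close>, a condition that passes to
  unions of chains; this is what makes Zorn's lemma applicable.
\<close>

lemma proper_left_ideal_in_maximal:
  assumes I: "left_ideal I R" and proper: "\<one> \<notin> I"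
  obtains M where "maximal_left_ideal M R" and "I \<subseteq> M" and "\<one> \<notin> M"
proof -
  let ?P = "{K. left_ideal K R \<and> I \<subseteq> K \<and> \<one> \<notin> K}"
  have "\<exists>M\<in>?P. \<forall>K\<in>?P. M \<subseteq> K \<longrightarrow> K = M"
  proof (rule subset_Zorn_nonempty)
    show "?P \<noteq> {}"
      using I proper by blast
    fix C assume "C \<noteq> {}" and chain: "subset.chain ?P C"
    moreover have "subset.chain {K. left_ideal K R} C"
      using chain by (auto simp: subset.chain_def)
    ultimately have "left_ideal (\<Union>C) R"
      by (blast intro: left_ideal_chain_Union)
    moreover have "I \<subseteq> \<Union>C" "\<one> \<notin> \<Union>C"
      using \<open>C \<noteq> {}\<close> chain unfolding subset.chain_def by blast+
    ultimately show "\<Union>C \<in> ?P"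
      by blast
  qed
  then obtain M where "M \<in> ?P" and max: "\<forall>K\<in>?P. M \<subseteq> K \<longrightarrow> K = M"
    by (rule bexE)
  then have M: "left_ideal M R" "I \<subseteq> M" "\<one> \<notin> M"
    by auto
  have "K = M \<or> K = carrier R" if "left_ideal K R" "M \<subseteq> K" for K
  proof (cases "\<one> \<in> K")
    case True
    then show ?thesis
      using left_ideal_eq_carrier_if_one that(1) by simp
  next
    case False
    then have "K \<in> ?P"
      using that M(2) by auto
    then show ?thesis
      using max that(2) by simp
  qed
  moreover have "carrier R \<noteq> M"
    using M(3) by auto
  ultimately have "maximal_left_ideal M R"
    using M(1) by (auto simp: maximal_left_ideal_def maximal_left_ideal_axioms_def)
  then show thesis
    using M(2,3) by (rule that)
qed

section \<open>Units from the Jacobson radical\<close>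

lemma jacobson_radical_l_closed:
  "\<lbrakk>x \<in> jacobson_radical R; r \<in> carrier R\<rbrakk> \<Longrightarrow> r \<otimes> x \<in> jacobson_radical R"
  by (auto simp: jacobson_radical_def maximal_left_ideal_def intro: left_ideal.I_l_closed)

lemma jacobson_radical_uminus_closed:
  assumes "x \<in> jacobson_radical R"
  shows "\<ominus> x \<in> jacobson_radical R"
proof -
  have "x \<in> carrier R"
    using assms by (simp add: jacobson_radical_def)
  then show ?thesis
    using jacobson_radical_l_closed[OF assms, of "\<ominus> \<one>"] by (simp add: l_minus)
qed

text \<open>
  Without a left inverse, \<open>1 - x\<close> generates a proper left ideal. A maximal left ideal above it
  contains both \<open>1 - x\<close> and \<open>x\<close>, hence \<open>1\<close>.
\<close>

lemma one_minus_jacobson_left_invertible: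
  assumes x: "x \<in> jacobson_radical R"
  obtains y where "y \<in> carrier R" and "y \<otimes> (\<one> \<ominus> x) = \<one>"
proof -
  have xc: "x \<in> carrier R"
    using x by (simp add: jacobson_radical_def)
  let ?I = "(\<lambda>r. r \<otimes> (\<one> \<ominus> x)) ` carrier R"
  have "\<one> \<in> ?I"
  proof (rule ccontr)
    assume "\<one> \<notin> ?I"
    then obtain M where M: "maximal_left_ideal M R" "?I \<subseteq> M" "\<one> \<notin> M"
      using proper_left_ideal_in_maximal left_ideal_left_multiples xc
      by (metis minus_closed one_closed)
    interpret maximal_left_ideal M R by fact
    have "\<one> \<ominus> x \<in> ?I"
      using xc by (intro image_eqI[of _ _ \<one>]) auto
    with M(2) have "\<one> \<ominus> x \<in> M"
      by blast
    moreover have "x \<in> M"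
      using x M(1) by (simp add: jacobson_radical_def)
    ultimately have "(\<one> \<ominus> x) \<oplus> x \<in> M"
      by (rule a_closed)
    moreover have "(\<one> \<ominus> x) \<oplus> x = \<one>"
      using xc by (simp add: a_minus_def a_assoc l_neg)
    ultimately show False
      using M(3) by simp
  qed
  then show thesis
    using that by force
qed

text \<open>
  A left inverse \<open>y\<close> of \<open>1 - x\<close> satisfies \<open>y = 1 + y x\<close>, so it has the same shape and is itself
  left invertible. Having an inverse on each side, \<open>y\<close> is a unit, and \<open>1 - x\<close> is its inverse.
\<close>

lemma one_minus_jacobson_Units:
  assumes x: "x \<in> jacobson_radical R"
  shows "\<one> \<ominus> x \<in> Units R"
proof -
  have xc: "x \<in> carrier R"
    using x by (simp add: jacobson_radical_def)
  obtain y where y: "y \<in> carrier R" "y \<otimes> (\<one> \<ominus> x) = \<one>"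
    using one_minus_jacobson_left_invertible x by blast
  have "\<ominus> (y \<otimes> x) \<in> jacobson_radical R"
    using x y(1) by (intro jacobson_radical_uminus_closed jacobson_radical_l_closed)
  then obtain t where t: "t \<in> carrier R" "t \<otimes> (\<one> \<ominus> \<ominus> (y \<otimes> x)) = \<one>"
    using one_minus_jacobson_left_invertible by blast
  have "y = y \<otimes> (\<one> \<ominus> x) \<oplus> y \<otimes> x"
    using xc y(1) by (simp add: a_minus_def r_distr r_minus a_assoc l_neg)
  then have "\<one> \<ominus> \<ominus> (y \<otimes> x) = y"
    using xc y by (simp add: a_minus_def)
  with t have "t \<otimes> y = \<one>"
    by simp
  then have "t = \<one> \<ominus> x"
    using inv_unique[of t y "\<one> \<ominus> x"] xc y t(1) by simp
  with \<open>t \<otimes> y = \<one>\<close> y t(1) show ?thesis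
    by (auto simp: Units_def)
qed

section \<open>Units from roots of radical elements\<close>

text \<open>The element \<open>g\<close> is the geometric sum \<open>1 + w + \<dots> + w\<^bsup>n-1\<^esup>\<close>.\<close>

lemma one_minus_divides_one_minus_pow:
  assumes w: "w \<in> carrier R"
  shows "\<exists>g\<in>carrier R. g \<otimes> (\<one> \<ominus> w) = \<one> \<ominus> w [^] n \<and> (\<one> \<ominus> w) \<otimes> g = \<one> \<ominus> w [^] (n::nat)"
proof (induction n)
  case 0
  show ?case
    using w by (intro bexI[of _ \<zero>]) (auto simp: a_minus_def r_neg)
next
  case (Suc n)
  then obtain g where g: "g \<in> carrier R"
    "g \<otimes> (\<one> \<ominus> w) = \<one> \<ominus> w [^] n" "(\<one> \<ominus> w) \<otimes> g = \<one> \<ominus> w [^] n"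
    by blast
  have pow: "w [^] n \<in> carrier R"
    using w by simp
  have comm: "w \<otimes> w [^] n = w [^] n \<otimes> w"
    using w by (metis nat_pow_Suc nat_pow_Suc2)
  have telescope: "(\<one> \<ominus> w [^] n) \<oplus> (w [^] n \<ominus> w [^] n \<otimes> w) = \<one> \<ominus> w [^] n \<otimes> w"
    using w pow by (simp add: a_minus_def a_assoc r_neg1)
  have "(g \<oplus> w [^] n) \<otimes> (\<one> \<ominus> w) = \<one> \<ominus> w [^] Suc n"
  proof -
    have "w [^] n \<otimes> (\<one> \<ominus> w) = w [^] n \<ominus> w [^] n \<otimes> w"
      using w pow by (simp add: a_minus_def r_distr r_minus)
    then show ?thesis
      using w pow g telescope by (simp add: l_distr)
  qed
  moreover have "(\<one> \<ominus> w) \<otimes> (g \<oplus> w [^] n) = \<one> \<ominus> w [^] Suc n"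
  proof -
    have "(\<one> \<ominus> w) \<otimes> w [^] n = w [^] n \<ominus> w [^] n \<otimes> w"
      using w pow comm by (simp add: a_minus_def l_distr l_minus)
    then show ?thesis
      using w pow g telescope by (simp add: r_distr)
  qed
  ultimately show ?case
    using g(1) pow by (metis a_closed)
qed

lemma one_minus_Units_if_one_minus_pow_Units:
  assumes w: "w \<in> carrier R" and unit: "\<one> \<ominus> w [^] (n::nat) \<in> Units R"
  shows "\<one> \<ominus> w \<in> Units R"
proof -
  obtain g where g: "g \<in> carrier R"
    "g \<otimes> (\<one> \<ominus> w) = \<one> \<ominus> w [^] n" "(\<one> \<ominus> w) \<otimes> g = \<one> \<ominus> w [^] n"
    using one_minus_divides_one_minus_pow w by blast
  let ?u = "\<one> \<ominus> w" and ?v = "inv (\<one> \<ominus> w [^] n)"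
  have u: "?u \<in> carrier R" and v: "?v \<in> carrier R"
    using w unit by auto
  have left: "(?v \<otimes> g) \<otimes> ?u = \<one>"
    using g u v unit by (simp add: m_assoc Units_l_inv)
  have right: "?u \<otimes> (g \<otimes> ?v) = \<one>"
    using g u v unit by (simp add: m_assoc[symmetric] Units_r_inv)
  have "?v \<otimes> g = g \<otimes> ?v"
    using inv_unique[OF left right] g u v by simp
  with left right g u v show ?thesis
    by (auto simp: Units_def intro!: bexI[of _ "g \<otimes> ?v"])
qed

lemma uminus_pow_cases:
  assumes z: "z \<in> carrier R"
  shows "(\<ominus> z) [^] (n::nat) = z [^] n \<or> (\<ominus> z) [^] n = \<ominus> (z [^] n)"
  by (induction n) (use z in \<open>auto simp: l_minus r_minus\<close>)

lemma sqrt_jacobson_radical_uminus_closed: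
  assumes "z \<in> sqrt_jacobson_radical R"
  shows "\<ominus> z \<in> sqrt_jacobson_radical R"
proof -
  obtain n :: nat where n: "z \<in> carrier R" "n \<ge> 1" "z [^] n \<in> jacobson_radical R"
    using assms by (auto simp: sqrt_jacobson_radical_def)
  then have "(\<ominus> z) [^] n \<in> jacobson_radical R"
    using uminus_pow_cases[of z n] jacobson_radical_uminus_closed by auto
  with n show ?thesis
    by (auto simp: sqrt_jacobson_radical_def)
qed

lemma one_plus_sqrt_jacobson_Units:
  assumes z: "z \<in> sqrt_jacobson_radical R"
  shows "\<one> \<oplus> z \<in> Units R"
proof -
  have zc: "z \<in> carrier R"
    using z by (simp add: sqrt_jacobson_radical_def)
  obtain n :: nat where "(\<ominus> z) [^] n \<in> jacobson_radical R"
    using sqrt_jacobson_radical_uminus_closed[OF z] by (auto simp: sqrt_jacobson_radical_def)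
  then have "\<one> \<ominus> (\<ominus> z) \<in> Units R"
    using zc one_minus_Units_if_one_minus_pow_Units one_minus_jacobson_Units by blast
  then show ?thesis
    using zc by (simp add: a_minus_def)
qed

end

section \<open>Clean decompositions\<close>

theorem lemma2p5:
  fixes R :: "('a, 'm) ring_scheme" (structure)
  assumes "ring R" and "\<one> \<noteq> \<zero>"
    and "sqrt_J_clean R"
  shows "clean R"
proof -
  interpret ring R by fact
  show ?thesis
    unfolding clean_def
  proof
    fix a assume a: "a \<in> carrier R"
    then have "a \<ominus> \<one> \<in> carrier R"
      by simp
    then obtain e z where e: "e \<in> idempotents R" and z: "z \<in> sqrt_jacobson_radical R"
      and decomp: "a \<ominus> \<one> = e \<oplus> z"
      using assms(3) unfolding sqrt_J_clean_def by blast
    have closed: "e \<in> carrier R" "z \<in> carrier R"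
      using e z by (auto simp: idempotents_def sqrt_jacobson_radical_def)
    have "a = (a \<ominus> \<one>) \<oplus> \<one>"
      using a by (simp add: a_minus_def a_assoc l_neg)
    also have "\<dots> = e \<oplus> (\<one> \<oplus> z)"
      using closed by (simp add: decomp a_ac)
    finally show "\<exists>e\<in>idempotents R. \<exists>u\<in>Units R. a = e \<oplus> u"
      using e one_plus_sqrt_jacobson_Units[OF z] by blast
  qed
qed

end
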